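(* Let $f:[0,\infty)\to[0,\infty)$ be continuous and nondecreasing with $f(u)\le Au^\alpha$ for all $u\ge0$, where $A>0$ and $\alpha>1+\frac2q$. If $0\le u_0\in L^1(\mathbb{R}^n)\cap L^\infty(\mathbb{R}^n)$ with $\|u_0\|_{L^1(\mathbb{R}^n)}$ and $\|u_0\|_{L^\infty(\mathbb{R}^n)}$ sufficiently small, then $$\int_0^\infty\Big\|\int_{\mathbb{R}^n}\Gamma(0,y;t,\cdot)u_0(y)\,dy\Big\|_{L^\infty(\mathbb{R}^n)}^{\alpha-1}dt<\frac{1}{A(\alpha-1)},$$ and consequently there exists a nonnegative global mild solution $u:[0,\infty)\to L^1(\mathbb{R}^n)$ of $u_t-\mathcal{L}u=f(u)$, $u(0)=u_0$, i.e. $u(t,x)=\int\Gamma(0,y;t,x)u_0(y)dy+\int_0^t\int\Gamma(0,y;t-\tau,x)f(u(\tau,y))\,dy\,d\tau$ for all $t\ge0$.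
   Context: Standing setting. Let $X=\{X_1,\dots,X_m\}$ be smooth vector fields on $\mathbb{R}^n$, linearly independent as vector fields, satisfying: (H1) there are integers $1=\sigma_1\le\dots\le\sigma_n$ such that, with dilations $\delta_\lambda(x)=(\lambda^{\sigma_1}x_1,\dots,\lambda^{\sigma_n}x_n)$, $\lambda>0$, each $X_j$ is homogeneous of degree $1$, i.e. $X_j(\phi\circ\delta_\lambda)=\lambda\,(X_j\phi)\circ\delta_\lambda$ for all $\phi\in C^\infty(\mathbb{R}^n)$, $\lambda>0$; (H2) Hörmander's rank condition at $0$: the values at $0$ of the vector fields in the Lie algebra generated by $X_1,\dots,X_m$ span $\mathbb{R}^n$. Put $q:=\sigma_1+\dots+\sigma_n$, $\mathcal{L}:=\sum_{j=1}^mX_j^2$, $\mathcal{H}:=\partial_t-\mathcal{L}$. $\Gamma(t,x;s,y)$ denotes the global fundamental solution (heat kernel) of $\mathcal{H}$; for $t>0$, $x\mapsto\int\Gamma(0,y;t,x)\varphi(y)dy$ is the heat semigroup of $\mathcal{L}$ applied to $\varphi$. Known properties: $\Gamma\ge0$; $\Gamma(t,x;s,y)=0$ if $s\le t$; $\Gamma(0,y;t,x)=\Gamma(0,x;t,y)$; $\int_{\mathbb{R}^n}\Gamma(0,y;t,x)\,dy=1$ for $t>0$; $\Gamma(0,y;t+s,x)=\int\Gamma(0,w;t,x)\Gamma(0,y;s,w)\,dw$ for $t,s>0$; there is $\rho>1$ with $\frac{1}{\rho|B_X(x,\sqrt s)|}e^{-\rho d_X(x,y)^2/s}\le\Gamma(0,x;s,y)\le\frac{\rho}{|B_X(x,\sqrt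 s)|}e^{-d_X(x,y)^2/(\rho s)}$ for $s>0$, where $d_X$ is the Carnot–Carathéodory distance of $X$ and $B_X$ its balls; and $|B_X(x,r)|\ge c\,r^q$ for some $c>0$ and all $x,r$. *)

theory Defs
  imports "HOL-Analysis.Analysis" "HOL-Probability.Essential_Supremum"
begin

fun Ck :: "nat \<Rightarrow> (real^'n \<Rightarrow> 'b::real_normed_vector) \<Rightarrow> bool" where
  "Ck 0 f = continuous_on UNIV f"
| "Ck (Suc k) f = (f differentiable_on UNIV \<and>
      (\<forall>v. Ck k (\<lambda>x. frechet_derivative f (at x) v)))"

definition smooth :: "(real^'n \<Rightarrow> 'b::real_normed_vector) \<Rightarrow> bool" where
  "smooth f \<longleftrightarrow> (\<forall>k. Ck k f)"

definition vf_apply :: "(real^'n \<Rightarrow> real^'n) \<Rightarrow> (real^'n \<Rightarrow> real) \<Rightarrow> real^'n \<Rightarrow> real" where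
  "vf_apply V \<phi> x = frechet_derivative \<phi> (at x) (V x)"

text \<open>Lie bracket [V,W] = V W - W V.\<close>
definition lie_bracket :: "(real^'n \<Rightarrow> real^'n) \<Rightarrow> (real^'n \<Rightarrow> real^'n) \<Rightarrow> real^'n \<Rightarrow> real^'n" where
  "lie_bracket V W x = frechet_derivative W (at x) (V x) - frechet_derivative V (at x) (W x)"

inductive_set lie_alg :: "(nat \<Rightarrow> real^'n \<Rightarrow> real^'n) \<Rightarrow> nat \<Rightarrow> (real^'n \<Rightarrow> real^'n) set"
  for X m where
  gen: "j < m \<Longrightarrow> X j \<in> lie_alg X m"
| add: "V \<in> lie_alg X m \<Longrightarrow> W \<in> lie_alg X m \<Longrightarrow> (\<lambda>x. V x + W x) \<in> lie_alg X m"
| smult: "V \<in> lie_alg X m \<Longrightarrow> (\<lambda>x. c *\<^sub>R V x) \<in> lie_alg X m"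
| bracket: "V \<in> lie_alg X m \<Longrightarrow> W \<in> lie_alg X m \<Longrightarrow> lie_bracket V W \<in> lie_alg X m"

definition dil :: "('n \<Rightarrow> nat) \<Rightarrow> real \<Rightarrow> real^'n \<Rightarrow> real^'n" where
  "dil \<sigma> l x = (\<chi> i. l ^ (\<sigma> i) * x $ i)"

text \<open>Standing hypotheses: smooth, linearly independent, (H1) homogeneous of degree 1
  w.r.t. the dilations with exponents sigma (min sigma = 1), (H2) Hoermander at 0.\<close>
definition hom_hoermander :: "(nat \<Rightarrow> real^'n \<Rightarrow> real^'n) \<Rightarrow> nat \<Rightarrow> ('n \<Rightarrow> nat) \<Rightarrow> bool" where
  "hom_hoermander X m \<sigma> \<longleftrightarrow>
     (\<forall>j<m. smooth (X j)) \<and>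
     (\<forall>c::nat \<Rightarrow> real. (\<forall>x. (\<Sum>j<m. c j *\<^sub>R X j x) = 0) \<longrightarrow> (\<forall>j<m. c j = 0)) \<and>
     (\<exists>i. \<sigma> i = 1) \<and> (\<forall>i. 1 \<le> \<sigma> i) \<and>
     (\<forall>j<m. \<forall>l>0. \<forall>\<phi>::real^'n \<Rightarrow> real. smooth \<phi> \<longrightarrow>
        (\<forall>x. vf_apply (X j) (\<phi> \<circ> dil \<sigma> l) x = l * vf_apply (X j) \<phi> (dil \<sigma> l x))) \<and>
     span ((\<lambda>V. V 0) ` lie_alg X m) = UNIV"

definition subunit :: "(nat \<Rightarrow> real^'n \<Rightarrow> real^'n) \<Rightarrow> nat \<Rightarrow> (real \<Rightarrow> real^'n) \<Rightarrow> real \<Rightarrow> bool" where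
  "subunit X m \<gamma> T \<longleftrightarrow> T \<ge> 0 \<and> (\<exists>L. L-lipschitz_on {0..T} \<gamma>) \<and>
     (AE t in lborel. t \<in> {0..T} \<longrightarrow>
        (\<exists>a::nat \<Rightarrow> real. (\<gamma> has_vector_derivative (\<Sum>j<m. a j *\<^sub>R X j (\<gamma> t))) (at t)
            \<and> (\<Sum>j<m. (a j)\<^sup>2) \<le> 1))"

definition cc_dist :: "(nat \<Rightarrow> real^'n \<Rightarrow> real^'n) \<Rightarrow> nat \<Rightarrow> real^'n \<Rightarrow> real^'n \<Rightarrow> real" where
  "cc_dist X m x y = Inf {T. \<exists>\<gamma>. subunit X m \<gamma> T \<and> \<gamma> 0 = x \<and> \<gamma> T = y}"

definition cc_ball :: "(nat \<Rightarrow> real^'n \<Rightarrow> real^'n) \<Rightarrow> nat \<Rightarrow> real^'n \<Rightarrow> real \<Rightarrow> (real^'n) set" where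
  "cc_ball X m x r = {y. cc_dist X m x y < r}"

definition heat_kernel_props ::
  "(nat \<Rightarrow> real^'n \<Rightarrow> real^'n) \<Rightarrow> nat \<Rightarrow> (real \<Rightarrow> real^'n \<Rightarrow> real \<Rightarrow> real^'n \<Rightarrow> real) \<Rightarrow> bool" where
  "heat_kernel_props X m \<Gamma> \<longleftrightarrow>
     (\<lambda>(t, x, s, y). \<Gamma> t x s y) \<in> borel_measurable borel \<and>
     (\<forall>t x s y. \<Gamma> t x s y \<ge> 0) \<and>
     (\<forall>t x s y. s \<le> t \<longrightarrow> \<Gamma> t x s y = 0) \<and>
     (\<forall>x y t. \<Gamma> 0 y t x = \<Gamma> 0 x t y) \<and>
     (\<forall>x t. t > 0 \<longrightarrow> (\<integral>\<^sup>+ y. ennreal (\<Gamma> 0 y t x) \<partial>lborel) = 1) \<and>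
     (\<forall>x y t s. t > 0 \<longrightarrow> s > 0 \<longrightarrow>
        ennreal (\<Gamma> 0 y (t + s) x) = (\<integral>\<^sup>+ w. ennreal (\<Gamma> 0 w t x * \<Gamma> 0 y s w) \<partial>lborel)) \<and>
     (\<exists>\<rho>>1. \<forall>x y s. s > 0 \<longrightarrow>
        1 / (\<rho> * measure lborel (cc_ball X m x (sqrt s))) * exp (- \<rho> * (cc_dist X m x y)\<^sup>2 / s)
          \<le> \<Gamma> 0 x s y \<and>
        \<Gamma> 0 x s y \<le> \<rho> / measure lborel (cc_ball X m x (sqrt s)) * exp (- (cc_dist X m x y)\<^sup>2 / (\<rho> * s)))"

definition ball_volume_bound :: "(nat \<Rightarrow> real^'n \<Rightarrow> real^'n) \<Rightarrow> nat \<Rightarrow> nat \<Rightarrow> bool" where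
  "ball_volume_bound X m q \<longleftrightarrow> (\<exists>c>0. \<forall>x r. r > 0 \<longrightarrow>
      ennreal (c * r ^ q) \<le> emeasure lborel (cc_ball X m x r))"

end

theory Submission
  imports Defs
begin

text \<open>
  The Gaussian upper bound together with the volume bound \<open>|B_X(x,r)| \<ge> c r^q\<close> gives
  \<open>\<Gamma>(0,x;t,y) \<le> M t^(-q/2)\<close>. Hence, if \<open>u\<^sub>0\<close> has \<open>L\<^sup>1\<close> and \<open>L\<^sup>\<infinity>\<close> norm at most \<open>\<epsilon>\<close>,
  the heat flow \<open>S(t)u\<^sub>0\<close> is bounded by \<open>B(t) = \<epsilon> min 1 (M t^(-q/2))\<close>, and
  \<open>\<integral>\<^sub>0\<^sup>\<infinity> B(t)^(\<alpha>-1) dt = \<epsilon>^(\<alpha>-1) C\<close> with \<open>C < \<infinity>\<close> precisely because \<open>(\<alpha>-1) q/2 > 1\<close>.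

  For small \<open>\<epsilon>\<close> the function \<open>2 S(t)u\<^sub>0\<close> is a supersolution of the Duhamel map
  \<open>\<Phi>(v)(t) = S(t)u\<^sub>0 + \<integral>\<^sub>0\<^sup>t S(t-\<tau>) f(v(\<tau>)) d\<tau>\<close>: by the growth bound
  \<open>f(2 S(\<tau>)u\<^sub>0) \<le> A 2^\<alpha> B(\<tau>)^(\<alpha>-1) S(\<tau>)u\<^sub>0\<close>, and the semigroup property turns
  \<open>S(t-\<tau>) S(\<tau>)u\<^sub>0\<close> into \<open>S(t)u\<^sub>0\<close>. Since \<open>\<Phi>\<close> is monotone, the Picard iterates starting
  from \<open>0\<close> increase and stay below \<open>2 S(t)u\<^sub>0\<close>; by monotone convergence their limit is a
  fixed point of \<open>\<Phi>\<close>, i.e. a mild solution.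
\<close>

lemma measurable_pred_mem_atLeastAtMost [measurable (raw)]:
  fixes g h :: "'a \<Rightarrow> real"
  assumes [measurable]: "g \<in> N \<rightarrow>\<^sub>M borel" "h \<in> N \<rightarrow>\<^sub>M borel"
  shows "Measurable.pred N (\<lambda>z. h z \<in> {0..g z})"
  unfolding atLeastAtMost_iff by measurable

lemma le_powr_of_volume_lower_bound:
  fixes B :: "'a::euclidean_space set"
  assumes "\<rho> > 0" "c > 0" "s > 0"
    and upper: "G \<le> \<rho> / measure lborel B * exp (- d\<^sup>2 / (\<rho> * s))"
    and volume: "ennreal (c * sqrt s ^ Q) \<le> emeasure lborel B"
  shows "G \<le> \<rho> / c * s powr (- real Q / 2)"
proof -
  have "exp (- d\<^sup>2 / (\<rho> * s)) \<le> 1"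
    using assms(1,3) by simp
  then have "G \<le> \<rho> / measure lborel B"
    using upper assms(1) by (smt (verit) divide_nonneg_nonneg measure_nonneg mult_left_le)
  also have "\<dots> \<le> \<rho> / c * s powr (- real Q / 2)"
  proof (cases "emeasure lborel B = \<infinity>")
    case True
    then show ?thesis using assms(1-3) by (simp add: measure_def)
  next
    case False
    have "sqrt s ^ Q = s powr (real Q / 2)"
      using \<open>s > 0\<close> by (simp add: powr_half_sqrt[symmetric] powr_realpow[symmetric] powr_powr)
    then have "ennreal (c * s powr (real Q / 2)) \<le> ennreal (measure lborel B)"
      using volume False by (simp add: emeasure_eq_ennreal_measure)
    then have volume_le: "c * s powr (real Q / 2) \<le> measure lborel B"
      by (simp add: ennreal_le_iff)
    then have "\<rho> / measure lborel B \<le> \<rho> / (c * s powr (real Q / 2))"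
      using assms(1-3) by (intro divide_left_mono) (auto intro!: mult_pos_pos less_le_trans[OF _ volume_le])
    then show ?thesis using \<open>s > 0\<close> by (simp add: powr_minus_divide)
  qed
  finally show ?thesis .
qed

lemma nn_integral_min_powr_finite:
  fixes M a \<beta> :: real
  assumes "M > 0" "\<beta> > 0" "a * \<beta> > 1"
  shows "(\<integral>\<^sup>+ \<tau>\<in>{0<..}. ennreal (min 1 (M * \<tau> powr (-a)) powr \<beta>) \<partial>lborel) < \<infinity>"
proof -
  let ?tail = "\<lambda>\<tau>::real. ennreal (M powr \<beta>) * (ennreal (\<tau> powr (-(a * \<beta>))) * indicator {1..} \<tau>)"
  have "(\<integral>\<^sup>+ \<tau>\<in>{0<..}. ennreal (min 1 (M * \<tau> powr (-a)) powr \<beta>) \<partial>lborel)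
      \<le> (\<integral>\<^sup>+ \<tau>. indicator {0<..1} \<tau> + ?tail \<tau> \<partial>lborel)"
  proof (rule nn_integral_mono)
    fix \<tau> :: real
    have min_nonneg: "0 \<le> min 1 (M * \<tau> powr (-a))" using \<open>M > 0\<close> by simp
    consider "\<tau> \<le> 0" | "0 < \<tau>" "\<tau> \<le> 1" | "1 < \<tau>" by linarith
    then show "ennreal (min 1 (M * \<tau> powr (-a)) powr \<beta>) * indicator {0<..} \<tau>
        \<le> indicator {0<..1} \<tau> + ?tail \<tau>"
    proof cases
      case 2
      have "min 1 (M * \<tau> powr (-a)) powr \<beta> \<le> 1 powr \<beta>"
        using min_nonneg \<open>\<beta> > 0\<close> by (intro powr_mono2) auto
      then show ?thesis using 2 by (simp add: ennreal_leI add_increasing2)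
    next
      case 3
      have "min 1 (M * \<tau> powr (-a)) powr \<beta> \<le> (M * \<tau> powr (-a)) powr \<beta>"
        using min_nonneg \<open>\<beta> > 0\<close> by (intro powr_mono2) auto
      also have "\<dots> = M powr \<beta> * \<tau> powr (-(a * \<beta>))"
        using \<open>M > 0\<close> 3 by (simp add: powr_mult powr_powr mult_ac)
      finally show ?thesis using 3 \<open>M > 0\<close>
        by (simp add: ennreal_mult[symmetric] ennreal_leI add_increasing)
    qed simp
  qed
  also have "\<dots> = emeasure lborel {0<..1::real} + ennreal (M powr \<beta>) *
      (\<integral>\<^sup>+ \<tau>. ennreal (\<tau> powr (-(a * \<beta>))) * indicator {1..} \<tau> \<partial>lborel)"
    by (subst nn_integral_add) (auto simp: nn_integral_cmult)
  also have "(\<integral>\<^sup>+ \<tau>. ennreal (\<tau> powr (-(a * \<beta>))) * indicator {1..} \<tau> \<partial>lborel)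
      = ennreal (-(1 powr (-(a * \<beta>) + 1)) / (-(a * \<beta>) + 1))"
    by (rule nn_integral_has_integral_lebesgue'[OF _ has_integral_powr_to_inf])
      (use assms in auto)
  finally show ?thesis by (simp add: ennreal_mult_less_top le_less_trans)
qed

lemma esssup_lborel_abs_nonneg: "0 \<le> esssup lborel (\<lambda>x::'a::euclidean_space. ereal \<bar>g x\<bar>)"
proof -
  have "esssup lborel (\<lambda>x::'a. 0::ereal) = 0" by (rule esssup_const) simp
  moreover have "esssup lborel (\<lambda>x::'a. 0::ereal) \<le> esssup lborel (\<lambda>x. ereal \<bar>g x\<bar>)"
    by (rule esssup_mono) auto
  ultimately show ?thesis by simp
qed

lemma ex_pos_powr_mult_less:
  fixes \<beta> C c :: real
  assumes "\<beta> > 0" "C \<ge> 0" "c > 0"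
  shows "\<exists>\<epsilon>>0. \<epsilon> powr \<beta> * C < c"
proof -
  define \<epsilon> where "\<epsilon> = (c / (C + 1)) powr (1 / \<beta>)"
  have "\<epsilon> powr \<beta> = c / (C + 1)"
    using assms by (simp add: \<epsilon>_def powr_powr)
  moreover have "c / (C + 1) * C < c"
    using assms by (simp add: field_simps)
  ultimately show ?thesis
    using assms by (intro exI[of _ \<epsilon>]) (simp add: \<epsilon>_def)
qed

locale heat_kernel =
  fixes \<Gamma> :: "real \<Rightarrow> real^'n \<Rightarrow> real \<Rightarrow> real^'n \<Rightarrow> real" and M q :: real
  assumes kernel_measurable: "(\<lambda>(t, x, s, y). \<Gamma> t x s y) \<in> borel_measurable borel"
    and kernel_nonneg: "\<And>t x s y. \<Gamma> t x s y \<ge> 0"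
    and kernel_vanish: "\<And>t x s y. s \<le> t \<Longrightarrow> \<Gamma> t x s y = 0"
    and kernel_sym: "\<And>x y t. \<Gamma> 0 y t x = \<Gamma> 0 x t y"
    and kernel_mass: "\<And>x t. t > 0 \<Longrightarrow> (\<integral>\<^sup>+ y. ennreal (\<Gamma> 0 y t x) \<partial>lborel) = 1"
    and kernel_chapman_kolmogorov: "\<And>x y t s. t > 0 \<Longrightarrow> s > 0 \<Longrightarrow>
        ennreal (\<Gamma> 0 y (t + s) x) = (\<integral>\<^sup>+ w. ennreal (\<Gamma> 0 w t x * \<Gamma> 0 y s w) \<partial>lborel)"
    and kernel_le: "\<And>x y s. s > 0 \<Longrightarrow> \<Gamma> 0 x s y \<le> M * s powr (-q/2)"
    and M_pos: "M > 0" and q_pos: "q > 0"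
begin

lemma kernel_measurable_comp [measurable (raw)]:
  assumes [measurable]: "g1 \<in> N \<rightarrow>\<^sub>M borel" "g2 \<in> N \<rightarrow>\<^sub>M borel" "g3 \<in> N \<rightarrow>\<^sub>M borel" "g4 \<in> N \<rightarrow>\<^sub>M borel"
  shows "(\<lambda>z. \<Gamma> (g1 z) (g2 z) (g3 z) (g4 z)) \<in> borel_measurable N"
proof -
  have \<Gamma>: "(\<lambda>(t, x, s, y). \<Gamma> t x s y) \<in> borel_measurable (borel \<Otimes>\<^sub>M (borel \<Otimes>\<^sub>M (borel \<Otimes>\<^sub>M borel)))"
    using kernel_measurable by (simp add: borel_prod)
  have "(\<lambda>z. (g1 z, g2 z, g3 z, g4 z)) \<in> N \<rightarrow>\<^sub>M (borel \<Otimes>\<^sub>M (borel \<Otimes>\<^sub>M (borel \<Otimes>\<^sub>M borel)))"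
    by measurable
  from measurable_compose[OF this \<Gamma>] show ?thesis by simp
qed

definition decay_integral :: "real \<Rightarrow> ennreal" where
  "decay_integral \<beta> = (\<integral>\<^sup>+ \<tau>\<in>{0<..}. ennreal (min 1 (M * \<tau> powr (-q/2)) powr \<beta>) \<partial>lborel)"

lemma decay_integral_finite:
  assumes "\<beta> > 0" "\<beta> * q / 2 > 1"
  shows "decay_integral \<beta> < \<infinity>"
  unfolding decay_integral_def minus_divide_left[symmetric]
  using assms by (intro nn_integral_min_powr_finite M_pos) (simp_all add: field_simps)

lemma ex_small_data_threshold:
  assumes "A > 0" "\<alpha> > 1 + 2 / q"
  shows "\<exists>\<epsilon>>0. ennreal (A * 2 powr \<alpha> * \<epsilon> powr (\<alpha> - 1)) * decay_integral (\<alpha> - 1) \<le> 1 \<and>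
    ennreal (\<epsilon> powr (\<alpha> - 1)) * decay_integral (\<alpha> - 1) < ennreal (1 / (A * (\<alpha> - 1)))"
proof -
  have "\<alpha> - 1 > 0" using assms(2) q_pos by (smt (verit) divide_pos_pos)
  moreover have "(\<alpha> - 1) * q / 2 > 1"
    using assms(2) q_pos by (simp add: field_simps)
  ultimately have "decay_integral (\<alpha> - 1) < \<infinity>" by (rule decay_integral_finite)
  then obtain C where C: "decay_integral (\<alpha> - 1) = ennreal C" "C \<ge> 0"
    by (cases "decay_integral (\<alpha> - 1)") auto
  obtain \<epsilon> where "\<epsilon> > 0" and \<epsilon>: "\<epsilon> powr (\<alpha> - 1) * C < min (1 / (A * 2 powr \<alpha>)) (1 / (A * (\<alpha> - 1)))"
    using ex_pos_powr_mult_less[OF \<open>\<alpha> - 1 > 0\<close> \<open>C \<ge> 0\<close>, of "min (1 / (A * 2 powr \<alpha>)) (1 / (A * (\<alpha> - 1)))"]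
      \<open>A > 0\<close> \<open>\<alpha> - 1 > 0\<close> by auto
  have "A * 2 powr \<alpha> * \<epsilon> powr (\<alpha> - 1) * C \<le> 1"
    using \<epsilon> \<open>A > 0\<close> by (simp add: field_simps)
  moreover have "\<epsilon> powr (\<alpha> - 1) * C < 1 / (A * (\<alpha> - 1))"
    using \<epsilon> by simp
  ultimately show ?thesis
    using \<open>\<epsilon> > 0\<close> \<open>A > 0\<close> \<open>\<alpha> - 1 > 0\<close> C
    by (intro exI[of _ \<epsilon>]) (auto simp: ennreal_mult'[symmetric] ennreal_lessI)
qed

end

lemma hom_hoermander_homogeneous_dim_pos:
  assumes "hom_hoermander X m \<sigma>"
  shows "(\<Sum>i\<in>UNIV. \<sigma> i) > 0"
proof -
  have "1 \<le> \<sigma> undefined" using assms unfolding hom_hoermander_def by blast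
  also have "\<sigma> undefined \<le> (\<Sum>i\<in>UNIV. \<sigma> i)" by (rule member_le_sum) auto
  finally show ?thesis by simp
qed

lemma heat_kernel_if_props:
  assumes "heat_kernel_props X m \<Gamma>" "ball_volume_bound X m Q" "Q > 0"
  shows "\<exists>M. heat_kernel \<Gamma> M (real Q)"
proof -
  obtain \<rho> where "\<rho> > 1" and upper: "\<And>x y s. s > 0 \<Longrightarrow>
      \<Gamma> 0 x s y \<le> \<rho> / measure lborel (cc_ball X m x (sqrt s)) * exp (- (cc_dist X m x y)\<^sup>2 / (\<rho> * s))"
    using assms(1) unfolding heat_kernel_props_def by force
  obtain c where "c > 0"
    and volume: "\<And>x r. r > 0 \<Longrightarrow> ennreal (c * r ^ Q) \<le> emeasure lborel (cc_ball X m x r)"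
    using assms(2) unfolding ball_volume_bound_def by blast
  have "\<forall>x y s. s > 0 \<longrightarrow> \<Gamma> 0 x s y \<le> \<rho> / c * s powr (- real Q / 2)"
  proof (intro allI impI)
    fix x y and s :: real
    assume "s > 0"
    then show "\<Gamma> 0 x s y \<le> \<rho> / c * s powr (- real Q / 2)"
      using \<open>\<rho> > 1\<close> \<open>c > 0\<close> upper volume[of "sqrt s" x] by (intro le_powr_of_volume_lower_bound) auto
  qed
  moreover have "\<rho> / c > 0" "real Q > 0"
    using \<open>\<rho> > 1\<close> \<open>c > 0\<close> assms(3) by auto
  ultimately have "heat_kernel \<Gamma> (\<rho> / c) (real Q)"
    using assms(1) unfolding heat_kernel_props_def heat_kernel_def
    by (-, elim conjE, intro conjI) assumption+
  then show ?thesis ..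
qed

locale heat_flow = heat_kernel \<Gamma> M q
  for \<Gamma> :: "real \<Rightarrow> real^'n \<Rightarrow> real \<Rightarrow> real^'n \<Rightarrow> real" and M q +
  fixes u0 :: "real^'n \<Rightarrow> real" and \<epsilon> :: real
  assumes u0_nonneg: "AE y in lborel. u0 y \<ge> 0"
    and u0_integrable: "integrable lborel u0"
    and u0_L1: "(\<integral>y. \<bar>u0 y\<bar> \<partial>lborel) \<le> \<epsilon>"
    and u0_Linf: "esssup lborel (\<lambda>y. ereal \<bar>u0 y\<bar>) \<le> ereal \<epsilon>"
begin

lemma u0_measurable [measurable]: "u0 \<in> borel_measurable borel"
  using borel_measurable_integrable[OF u0_integrable] by simp

lemma eps_nonneg: "\<epsilon> \<ge> 0"
  using u0_L1 by (rule order_trans[rotated]) (auto intro: integral_nonneg_AE)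

lemma u0_le: "AE y in lborel. u0 y \<le> \<epsilon>"
  using esssup_AE[of "\<lambda>y. ereal \<bar>u0 y\<bar>" lborel]
proof eventually_elim
  case (elim y)
  then have "ereal \<bar>u0 y\<bar> \<le> ereal \<epsilon>" using u0_Linf by (rule order_trans)
  then show ?case by simp
qed

lemma nn_integral_u0_le: "(\<integral>\<^sup>+ y. ennreal (u0 y) \<partial>lborel) \<le> ennreal \<epsilon>"
proof -
  have "(\<integral>\<^sup>+ y. ennreal (u0 y) \<partial>lborel) \<le> (\<integral>\<^sup>+ y. ennreal \<bar>u0 y\<bar> \<partial>lborel)"
    by (intro nn_integral_mono ennreal_leI) simp
  also have "\<dots> = ennreal (\<integral>y. \<bar>u0 y\<bar> \<partial>lborel)"
    using u0_integrable by (intro nn_integral_eq_integral) auto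
  also have "\<dots> \<le> ennreal \<epsilon>" using u0_L1 by (rule ennreal_leI)
  finally show ?thesis .
qed

definition heat_u0 :: "real \<Rightarrow> real^'n \<Rightarrow> ennreal" where
  "heat_u0 t x = (\<integral>\<^sup>+ y. ennreal (\<Gamma> 0 y t x * u0 y) \<partial>lborel)"

definition decay_bound :: "real \<Rightarrow> real" where
  "decay_bound t = \<epsilon> * min 1 (M * t powr (-q/2))"

lemma heat_u0_measurable [measurable]: "(\<lambda>(t, x). heat_u0 t x) \<in> borel_measurable (lborel \<Otimes>\<^sub>M lborel)"
  unfolding heat_u0_def by measurable

lemma heat_u0_nonpos_time: "t \<le> 0 \<Longrightarrow> heat_u0 t x = 0"
  unfolding heat_u0_def by (simp add: kernel_vanish)

lemma heat_u0_le_Linf: "heat_u0 t x \<le> ennreal \<epsilon>"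
proof (cases "t > 0")
  case True
  have "heat_u0 t x \<le> (\<integral>\<^sup>+ y. ennreal (\<Gamma> 0 y t x) * ennreal \<epsilon> \<partial>lborel)"
    unfolding heat_u0_def
  proof (rule nn_integral_mono_AE)
    show "AE y in lborel. ennreal (\<Gamma> 0 y t x * u0 y) \<le> ennreal (\<Gamma> 0 y t x) * ennreal \<epsilon>"
      using u0_le
    proof eventually_elim
      case (elim y)
      then have "\<Gamma> 0 y t x * u0 y \<le> \<Gamma> 0 y t x * \<epsilon>" by (simp add: mult_left_mono kernel_nonneg)
      then show ?case by (simp add: ennreal_mult[symmetric] kernel_nonneg eps_nonneg ennreal_leI)
    qed
  qed
  also have "\<dots> = ennreal \<epsilon>" using kernel_mass[OF True] by (simp add: nn_integral_multc)
  finally show ?thesis .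
qed (simp add: heat_u0_nonpos_time)

lemma heat_u0_le_L1:
  assumes "t > 0"
  shows "heat_u0 t x \<le> ennreal (M * \<epsilon> * t powr (-q/2))"
proof -
  have "heat_u0 t x \<le> (\<integral>\<^sup>+ y. ennreal (M * t powr (-q/2)) * ennreal (u0 y) \<partial>lborel)"
    unfolding heat_u0_def
  proof (rule nn_integral_mono)
    fix y
    show "ennreal (\<Gamma> 0 y t x * u0 y) \<le> ennreal (M * t powr (-q/2)) * ennreal (u0 y)"
    proof (cases "u0 y \<ge> 0")
      case True
      then have "\<Gamma> 0 y t x * u0 y \<le> M * t powr (-q/2) * u0 y"
        using kernel_le[OF assms] by (rule mult_right_mono[rotated])
      then show ?thesis using True M_pos by (simp add: ennreal_mult[symmetric] ennreal_leI)
    next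
      case False
      then show ?thesis by (simp add: mult_nonneg_nonpos kernel_nonneg ennreal_neg)
    qed
  qed
  also have "\<dots> = ennreal (M * t powr (-q/2)) * (\<integral>\<^sup>+ y. ennreal (u0 y) \<partial>lborel)"
    by (simp add: nn_integral_cmult)
  also have "\<dots> \<le> ennreal (M * t powr (-q/2)) * ennreal \<epsilon>"
    using nn_integral_u0_le by (rule mult_left_mono) simp
  also have "\<dots> = ennreal (M * \<epsilon> * t powr (-q/2))"
    using M_pos eps_nonneg by (simp add: ennreal_mult'[symmetric] mult_ac)
  finally show ?thesis .
qed

lemma decay_bound_measurable [measurable]: "decay_bound \<in> borel_measurable borel"
  unfolding decay_bound_def by measurable

lemma decay_bound_nonneg: "decay_bound t \<ge> 0"
  unfolding decay_bound_def using eps_nonneg M_pos by simp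

lemma heat_u0_le_decay_bound: "t > 0 \<Longrightarrow> heat_u0 t x \<le> ennreal (decay_bound t)"
  using heat_u0_le_Linf[of t x] heat_u0_le_L1[of t x] eps_nonneg M_pos
  by (simp add: decay_bound_def min_mult_distrib_left mult_ac min_ennreal[symmetric])

lemma heat_u0_finite: "heat_u0 t x < \<infinity>"
  using heat_u0_le_Linf[of t x] by (simp add: le_less_trans)

lemma heat_u0_semigroup:
  assumes "0 < \<tau>" "\<tau> < t"
  shows "(\<integral>\<^sup>+ y. ennreal (\<Gamma> 0 y (t - \<tau>) x) * heat_u0 \<tau> y \<partial>lborel) = heat_u0 t x"
proof -
  have "(\<integral>\<^sup>+ y. ennreal (\<Gamma> 0 y (t - \<tau>) x) * heat_u0 \<tau> y \<partial>lborel)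
      = (\<integral>\<^sup>+ y. (\<integral>\<^sup>+ z. ennreal (\<Gamma> 0 y (t - \<tau>) x) * ennreal (\<Gamma> 0 z \<tau> y * u0 z) \<partial>lborel) \<partial>lborel)"
    unfolding heat_u0_def by (subst nn_integral_cmult) auto
  also have "\<dots> = (\<integral>\<^sup>+ z. (\<integral>\<^sup>+ y. ennreal (\<Gamma> 0 y (t - \<tau>) x) * ennreal (\<Gamma> 0 z \<tau> y * u0 z) \<partial>lborel) \<partial>lborel)"
    by (rule lborel_pair.Fubini') measurable
  also have "\<dots> = (\<integral>\<^sup>+ z. ennreal (u0 z) * (\<integral>\<^sup>+ y. ennreal (\<Gamma> 0 y (t - \<tau>) x * \<Gamma> 0 z \<tau> y) \<partial>lborel) \<partial>lborel)"
    using kernel_nonneg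
    by (subst nn_integral_cmult[symmetric]) (auto intro!: nn_integral_cong simp: ennreal_mult'' mult_ac)
  also have "\<dots> = (\<integral>\<^sup>+ z. ennreal (u0 z) * ennreal (\<Gamma> 0 z t x) \<partial>lborel)"
    using assms
    by (intro nn_integral_cong) (simp add: kernel_chapman_kolmogorov[where t="t - \<tau>" and s=\<tau>, symmetric])
  also have "\<dots> = heat_u0 t x"
    unfolding heat_u0_def using kernel_nonneg by (intro nn_integral_cong) (simp add: ennreal_mult'' mult_ac)
  finally show ?thesis .
qed

lemma nn_integral_heat_u0:
  assumes "t > 0"
  shows "(\<integral>\<^sup>+ x. heat_u0 t x \<partial>lborel) = (\<integral>\<^sup>+ y. ennreal (u0 y) \<partial>lborel)"
proof -
  have "(\<integral>\<^sup>+ x. heat_u0 t x \<partial>lborel) = (\<integral>\<^sup>+ y. (\<integral>\<^sup>+ x. ennreal (\<Gamma> 0 y t x * u0 y) \<partial>lborel) \<partial>lborel)"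
    unfolding heat_u0_def by (rule lborel_pair.Fubini'[symmetric]) measurable
  also have "\<dots> = (\<integral>\<^sup>+ y. ennreal (u0 y) * (\<integral>\<^sup>+ x. ennreal (\<Gamma> 0 x t y) \<partial>lborel) \<partial>lborel)"
    using kernel_sym kernel_nonneg
    by (subst nn_integral_cmult[symmetric]) (auto intro!: nn_integral_cong simp: ennreal_mult'' mult.commute)
  also have "\<dots> = (\<integral>\<^sup>+ y. ennreal (u0 y) \<partial>lborel)" using kernel_mass[OF assms] by simp
  finally show ?thesis .
qed

lemma integral_heat_u0: "(\<integral>y. \<Gamma> 0 y t x * u0 y \<partial>lborel) = enn2real (heat_u0 t x)"
  unfolding heat_u0_def
  using u0_nonneg by (intro integral_eq_nn_integral) (auto simp: kernel_nonneg)

lemma esssup_heat_u0_le: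
  assumes "t > 0"
  shows "esssup lborel (\<lambda>x. ereal \<bar>\<integral>y. \<Gamma> 0 y t x * u0 y \<partial>lborel\<bar>) \<le> ereal (decay_bound t)"
  unfolding integral_heat_u0
  using heat_u0_le_decay_bound[OF assms] decay_bound_nonneg
  by (intro esssup_I) (auto simp: enn2real_leI)

lemma esssup_heat_u0_finite:
  assumes "t > 0"
  shows "esssup lborel (\<lambda>x. ereal \<bar>\<integral>y. \<Gamma> 0 y t x * u0 y \<partial>lborel\<bar>) < \<infinity>"
  using esssup_heat_u0_le[OF assms] by (rule le_less_trans) simp

lemma nn_integral_decay_bound_powr:
  assumes "c \<ge> 0"
  shows "(\<integral>\<^sup>+ \<tau>\<in>{0<..}. ennreal (c * decay_bound \<tau> powr \<beta>) \<partial>lborel) = ennreal (c * \<epsilon> powr \<beta>) * decay_integral \<beta>"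
  unfolding decay_integral_def decay_bound_def
  using assms eps_nonneg M_pos
  by (subst nn_integral_cmult[symmetric])
    (auto intro!: nn_integral_cong simp: powr_mult ennreal_mult' mult_ac)

lemma nn_integral_esssup_heat_u0_powr_le:
  assumes "\<beta> > 0"
  shows "(\<integral>\<^sup>+ t\<in>{0<..}. ennreal (real_of_ereal (esssup lborel (\<lambda>x. ereal \<bar>\<integral>y. \<Gamma> 0 y t x * u0 y \<partial>lborel\<bar>))
      powr \<beta>) \<partial>lborel) \<le> ennreal (\<epsilon> powr \<beta>) * decay_integral \<beta>"
proof -
  have "real_of_ereal (esssup lborel (\<lambda>x. ereal \<bar>\<integral>y. \<Gamma> 0 y t x * u0 y \<partial>lborel\<bar>)) powr \<beta>
      \<le> decay_bound t powr \<beta>" if "t > 0" for t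
  proof -
    let ?e = "esssup lborel (\<lambda>x. ereal \<bar>\<integral>y. \<Gamma> 0 y t x * u0 y \<partial>lborel\<bar>)"
    have "0 \<le> ?e" "?e \<le> ereal (decay_bound t)"
      using esssup_lborel_abs_nonneg esssup_heat_u0_le[OF that] by auto
    then have "0 \<le> real_of_ereal ?e" "real_of_ereal ?e \<le> decay_bound t"
      by (cases ?e; simp)+
    then show ?thesis using assms by (intro powr_mono2) auto
  qed
  then have "(\<integral>\<^sup>+ t\<in>{0<..}. ennreal (real_of_ereal (esssup lborel (\<lambda>x. ereal \<bar>\<integral>y. \<Gamma> 0 y t x * u0 y \<partial>lborel\<bar>))
      powr \<beta>) \<partial>lborel) \<le> (\<integral>\<^sup>+ t\<in>{0<..}. ennreal (1 * decay_bound t powr \<beta>) \<partial>lborel)"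
    by (intro nn_integral_mono) (auto simp: ennreal_leI indicator_def)
  also have "\<dots> = ennreal (\<epsilon> powr \<beta>) * decay_integral \<beta>"
    using nn_integral_decay_bound_powr[of 1 \<beta>] by simp
  finally show ?thesis .
qed

end

locale mild_problem = heat_flow \<Gamma> M q u0 \<epsilon>
  for \<Gamma> :: "real \<Rightarrow> real^'n \<Rightarrow> real \<Rightarrow> real^'n \<Rightarrow> real" and M q u0 \<epsilon> +
  fixes f :: "real \<Rightarrow> real" and A \<alpha> :: real
  assumes f_cont: "continuous_on {0..} f" and f_mono: "mono_on {0..} f"
    and f_nonneg: "\<And>u. u \<ge> 0 \<Longrightarrow> f u \<ge> 0"
    and f_le: "\<And>u. u \<ge> 0 \<Longrightarrow> f u \<le> A * u powr \<alpha>"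
    and A_pos: "A > 0" and \<alpha>_gt_1: "\<alpha> > 1"
    and small: "ennreal (A * 2 powr \<alpha> * \<epsilon> powr (\<alpha> - 1)) * decay_integral (\<alpha> - 1) \<le> 1"
begin

definition f_ext :: "real \<Rightarrow> real" where
  "f_ext s = f (max s 0)"

lemma f_ext_cont: "continuous_on UNIV f_ext"
proof -
  have "continuous_on UNIV (f \<circ> (\<lambda>s. max s 0))"
    by (rule continuous_on_compose) (auto intro!: continuous_intros continuous_on_subset[OF f_cont])
  then show ?thesis by (simp add: f_ext_def o_def)
qed

lemma f_ext_measurable [measurable]: "f_ext \<in> borel_measurable borel"
  using f_ext_cont by (rule borel_measurable_continuous_onI)

lemma f_ext_mono: "a \<le> b \<Longrightarrow> f_ext a \<le> f_ext b"
  unfolding f_ext_def by (rule mono_onD[OF f_mono]) auto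

lemma f_ext_nonneg: "f_ext a \<ge> 0"
  unfolding f_ext_def by (rule f_nonneg) simp

lemma f_ext_nonpos: "a \<le> 0 \<Longrightarrow> f_ext a = 0"
  using f_le[of 0] f_ext_nonneg[of a] by (simp add: f_ext_def max_absorb2)

lemma f_ext_double_le:
  assumes "0 \<le> p" "p \<le> b"
  shows "f_ext (2 * p) \<le> A * 2 powr \<alpha> * b powr (\<alpha> - 1) * p"
proof -
  have "f_ext (2 * p) \<le> A * (2 * p) powr \<alpha>"
    unfolding f_ext_def using assms by (simp add: f_le)
  also have "(2 * p) powr \<alpha> = 2 powr \<alpha> * (p powr (\<alpha> - 1) * p)"
    using assms(1) powr_add[of p "\<alpha> - 1" 1] by (simp add: powr_mult)
  also have "A * (2 powr \<alpha> * (p powr (\<alpha> - 1) * p)) \<le> A * (2 powr \<alpha> * (b powr (\<alpha> - 1) * p))"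
    using assms A_pos \<alpha>_gt_1 by (intro mult_left_mono mult_right_mono powr_mono2) auto
  finally show ?thesis by (simp add: mult_ac)
qed

definition heat_u0_real :: "real \<Rightarrow> real^'n \<Rightarrow> real" where
  "heat_u0_real t x = enn2real (heat_u0 t x)"

lemma heat_u0_real_nonneg: "heat_u0_real t x \<ge> 0"
  unfolding heat_u0_real_def by simp

lemma ennreal_heat_u0_real: "ennreal (heat_u0_real t x) = heat_u0 t x"
  unfolding heat_u0_real_def using heat_u0_finite[of t x] by simp

lemma ennreal_double_heat_u0_real: "ennreal (2 * heat_u0_real t x) = 2 * heat_u0 t x"
  using heat_u0_real_nonneg[of t x] by (simp add: ennreal_mult ennreal_heat_u0_real)

lemma heat_u0_real_le_decay_bound: "t > 0 \<Longrightarrow> heat_u0_real t x \<le> decay_bound t"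
  using heat_u0_le_decay_bound[of t x] decay_bound_nonneg[of t]
  unfolding heat_u0_real_def by (simp add: enn2real_leI)

definition duhamel :: "(real \<Rightarrow> real^'n \<Rightarrow> real) \<Rightarrow> real \<Rightarrow> real^'n \<Rightarrow> ennreal" where
  "duhamel v t x = heat_u0 t x +
     (\<integral>\<^sup>+ \<tau>\<in>{0..t}. (\<integral>\<^sup>+ y. ennreal (\<Gamma> 0 y (t - \<tau>) x * f_ext (v \<tau> y)) \<partial>lborel) \<partial>lborel)"

lemma duhamel_mono:
  assumes "\<And>t x. v t x \<le> w t x"
  shows "duhamel v t x \<le> duhamel w t x"
  unfolding duhamel_def
  by (intro add_left_mono nn_integral_mono mult_right_mono ennreal_leI mult_left_mono
      f_ext_mono assms kernel_nonneg) auto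

lemma duhamel_measurable:
  assumes [measurable]: "(\<lambda>(t, x). v t x) \<in> borel_measurable (lborel \<Otimes>\<^sub>M lborel)"
  shows "(\<lambda>(t, x). duhamel v t x) \<in> borel_measurable (lborel \<Otimes>\<^sub>M lborel)"
  unfolding duhamel_def by measurable

lemma duhamel_integrand_double_heat_u0_le:
  assumes "0 < \<tau>" "\<tau> \<le> t"
  shows "(\<integral>\<^sup>+ y. ennreal (\<Gamma> 0 y (t - \<tau>) x * f_ext (2 * heat_u0_real \<tau> y)) \<partial>lborel)
     \<le> ennreal (A * 2 powr \<alpha> * decay_bound \<tau> powr (\<alpha> - 1)) * heat_u0 t x"
proof (cases "\<tau> = t")
  case False
  let ?c = "A * 2 powr \<alpha> * decay_bound \<tau> powr (\<alpha> - 1)"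
  have "(\<integral>\<^sup>+ y. ennreal (\<Gamma> 0 y (t - \<tau>) x * f_ext (2 * heat_u0_real \<tau> y)) \<partial>lborel)
     \<le> (\<integral>\<^sup>+ y. ennreal ?c * (ennreal (\<Gamma> 0 y (t - \<tau>) x) * heat_u0 \<tau> y) \<partial>lborel)"
  proof (rule nn_integral_mono)
    fix y
    have "f_ext (2 * heat_u0_real \<tau> y) \<le> ?c * heat_u0_real \<tau> y"
      using heat_u0_real_nonneg heat_u0_real_le_decay_bound[OF assms(1)] by (rule f_ext_double_le)
    from mult_left_mono[OF this kernel_nonneg[of 0 y "t - \<tau>" x]]
    have "ennreal (\<Gamma> 0 y (t - \<tau>) x * f_ext (2 * heat_u0_real \<tau> y))
        \<le> ennreal (?c * (\<Gamma> 0 y (t - \<tau>) x * heat_u0_real \<tau> y))"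
      by (intro ennreal_leI) (simp add: mult_ac)
    also have "\<dots> = ennreal ?c * (ennreal (\<Gamma> 0 y (t - \<tau>) x) * heat_u0 \<tau> y)"
      using A_pos kernel_nonneg heat_u0_real_nonneg
      by (simp add: ennreal_mult ennreal_heat_u0_real[symmetric])
    finally show "ennreal (\<Gamma> 0 y (t - \<tau>) x * f_ext (2 * heat_u0_real \<tau> y))
        \<le> ennreal ?c * (ennreal (\<Gamma> 0 y (t - \<tau>) x) * heat_u0 \<tau> y)" .
  qed
  also have "\<dots> = ennreal ?c * heat_u0 t x"
    using heat_u0_semigroup[of \<tau> t x] assms False by (subst nn_integral_cmult) auto
  finally show ?thesis .
qed (simp add: kernel_vanish)

lemma duhamel_double_heat_u0_le: "duhamel (\<lambda>t x. 2 * heat_u0_real t x) t x \<le> 2 * heat_u0 t x"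
proof -
  let ?c = "\<lambda>\<tau>. A * 2 powr \<alpha> * decay_bound \<tau> powr (\<alpha> - 1)"
  have "(\<integral>\<^sup>+ \<tau>\<in>{0..t}. (\<integral>\<^sup>+ y. ennreal (\<Gamma> 0 y (t - \<tau>) x * f_ext (2 * heat_u0_real \<tau> y)) \<partial>lborel) \<partial>lborel)
      \<le> (\<integral>\<^sup>+ \<tau>. ennreal (?c \<tau>) * indicator {0<..} \<tau> * heat_u0 t x \<partial>lborel)"
  proof (rule nn_integral_mono)
    fix \<tau>
    consider "\<tau> \<notin> {0..t}" | "\<tau> = 0" | "0 < \<tau>" "\<tau> \<le> t" by (metis atLeastAtMost_iff not_less le_less)
    then show "(\<integral>\<^sup>+ y. ennreal (\<Gamma> 0 y (t - \<tau>) x * f_ext (2 * heat_u0_real \<tau> y)) \<partial>lborel) * indicator {0..t} \<tau>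
       \<le> ennreal (?c \<tau>) * indicator {0<..} \<tau> * heat_u0 t x"
    proof cases
      case 2
      then show ?thesis by (simp add: heat_u0_real_def heat_u0_nonpos_time f_ext_nonpos)
    next
      case 3
      then show ?thesis using duhamel_integrand_double_heat_u0_le[of \<tau> t x] by simp
    qed simp
  qed
  also have "\<dots> = (\<integral>\<^sup>+ \<tau>\<in>{0<..}. ennreal (?c \<tau>) \<partial>lborel) * heat_u0 t x"
    by (rule nn_integral_multc) measurable
  also have "\<dots> \<le> 1 * heat_u0 t x"
  proof (rule mult_right_mono)
    show "(\<integral>\<^sup>+ \<tau>\<in>{0<..}. ennreal (?c \<tau>) \<partial>lborel) \<le> 1"
      using nn_integral_decay_bound_powr[of "A * 2 powr \<alpha>" "\<alpha> - 1"] small A_pos by simp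
  qed simp
  also have "\<dots> = heat_u0 t x" by simp
  finally have "duhamel (\<lambda>t x. 2 * heat_u0_real t x) t x \<le> heat_u0 t x + heat_u0 t x"
    unfolding duhamel_def by (rule add_left_mono)
  then show ?thesis by (simp only: mult_2[of "heat_u0 t x"])
qed

lemma duhamel_le_double_heat_u0:
  assumes "\<And>t x. v t x \<le> 2 * heat_u0_real t x"
  shows "duhamel v t x \<le> 2 * heat_u0 t x"
  using duhamel_mono[OF assms] duhamel_double_heat_u0_le by (rule order_trans)

primrec picard :: "nat \<Rightarrow> real \<Rightarrow> real^'n \<Rightarrow> real" where
  "picard 0 = (\<lambda>t x. 0)"
| "picard (Suc k) = (\<lambda>t x. enn2real (duhamel (picard k) t x))"

lemma picard_measurable [measurable]:
  "(\<lambda>(t, x). picard k t x) \<in> borel_measurable (lborel \<Otimes>\<^sub>M lborel)"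
proof (induction k)
  case (Suc k)
  have "(\<lambda>(t, x). enn2real (duhamel (picard k) t x)) \<in> borel_measurable (lborel \<Otimes>\<^sub>M lborel)"
    using duhamel_measurable[OF Suc] by measurable
  then show ?case by simp
qed simp

lemma picard_nonneg: "0 \<le> picard k t x"
  by (cases k) simp_all

lemma picard_le: "picard k t x \<le> 2 * heat_u0_real t x"
proof (induction k arbitrary: t x)
  case 0
  then show ?case using heat_u0_real_nonneg by simp
next
  case (Suc k)
  have "enn2real (duhamel (picard k) t x) \<le> enn2real (2 * heat_u0 t x)"
    using duhamel_le_double_heat_u0[OF Suc] heat_u0_finite[of t x]
    by (intro enn2real_mono) (auto simp: ennreal_mult_less_top)
  then show ?case
    by (simp add: ennreal_double_heat_u0_real[symmetric] heat_u0_real_nonneg)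
qed

lemma duhamel_picard: "duhamel (picard k) t x = ennreal (picard (Suc k) t x)"
  using duhamel_le_double_heat_u0[of "picard k" t x, OF picard_le] heat_u0_finite[of t x]
  by (simp add: ennreal_mult_less_top top.not_eq_extremum le_less_trans)

lemma picard_le_Suc: "picard k t x \<le> picard (Suc k) t x"
proof (induction k arbitrary: t x)
  case 0
  then show ?case using picard_nonneg[of 1] by simp
next
  case (Suc k)
  have "duhamel (picard k) t x \<le> duhamel (picard (Suc k)) t x"
    using Suc by (rule duhamel_mono)
  then show ?case using picard_nonneg by (simp only: duhamel_picard ennreal_le_iff)
qed

definition picard_lim :: "real \<Rightarrow> real^'n \<Rightarrow> real" where
  "picard_lim t x = enn2real (SUP k. ennreal (picard k t x))"

lemma SUP_picard_le: "(SUP k. ennreal (picard k t x)) \<le> 2 * heat_u0 t x"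
  by (rule SUP_least) (simp only: ennreal_double_heat_u0_real[symmetric] ennreal_leI picard_le)

lemma ennreal_picard_lim: "ennreal (picard_lim t x) = (SUP k. ennreal (picard k t x))"
  unfolding picard_lim_def
  using SUP_picard_le[of t x] heat_u0_finite[of t x]
  by (simp add: ennreal_mult_less_top top.not_eq_extremum le_less_trans)

lemma picard_lim_measurable [measurable]:
  "(\<lambda>(t, x). picard_lim t x) \<in> borel_measurable (lborel \<Otimes>\<^sub>M lborel)"
  unfolding picard_lim_def by measurable

lemma picard_lim_nonneg: "0 \<le> picard_lim t x"
  unfolding picard_lim_def by simp

lemma picard_lim_le: "picard_lim t x \<le> 2 * heat_u0_real t x"
  using SUP_picard_le[of t x] heat_u0_real_nonneg[of t x]
  by (simp add: ennreal_picard_lim[symmetric] ennreal_double_heat_u0_real[symmetric])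

lemma picard_tendsto: "(\<lambda>k. picard k t x) \<longlonglongrightarrow> picard_lim t x"
proof -
  have "(\<lambda>k. ennreal (picard k t x)) \<longlonglongrightarrow> (SUP k. ennreal (picard k t x))"
    by (intro LIMSEQ_SUP incseq_SucI ennreal_leI picard_le_Suc)
  then have "(\<lambda>k. ennreal (picard k t x)) \<longlonglongrightarrow> ennreal (picard_lim t x)"
    by (simp add: ennreal_picard_lim)
  from tendsto_enn2real[OF this] show ?thesis by (simp add: picard_nonneg picard_lim_nonneg)
qed

lemma ennreal_f_ext_picard_lim:
  assumes "c \<ge> 0"
  shows "ennreal (c * f_ext (picard_lim \<tau> y)) = (SUP k. ennreal (c * f_ext (picard k \<tau> y)))"
proof -
  have "(\<lambda>k. ennreal (c * f_ext (picard k \<tau> y))) \<longlonglongrightarrow> ennreal (c * f_ext (picard_lim \<tau> y))"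
    using continuous_on_tendsto_compose[OF f_ext_cont picard_tendsto]
    by (intro tendsto_ennrealI tendsto_mult_left) auto
  moreover have "(\<lambda>k. ennreal (c * f_ext (picard k \<tau> y))) \<longlonglongrightarrow> (SUP k. ennreal (c * f_ext (picard k \<tau> y)))"
    using assms
    by (intro LIMSEQ_SUP incseq_SucI ennreal_leI mult_left_mono f_ext_mono picard_le_Suc)
  ultimately show ?thesis by (rule LIMSEQ_unique)
qed

lemma nn_integral_f_ext_picard_lim:
  "(\<integral>\<^sup>+ y. ennreal (\<Gamma> 0 y s x * f_ext (picard_lim \<tau> y)) \<partial>lborel)
    = (SUP k. \<integral>\<^sup>+ y. ennreal (\<Gamma> 0 y s x * f_ext (picard k \<tau> y)) \<partial>lborel)"
proof -
  have "(\<integral>\<^sup>+ y. ennreal (\<Gamma> 0 y s x * f_ext (picard_lim \<tau> y)) \<partial>lborel)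
      = (\<integral>\<^sup>+ y. (SUP k. ennreal (\<Gamma> 0 y s x * f_ext (picard k \<tau> y))) \<partial>lborel)"
    by (simp add: ennreal_f_ext_picard_lim kernel_nonneg)
  also have "\<dots> = (SUP k. \<integral>\<^sup>+ y. ennreal (\<Gamma> 0 y s x * f_ext (picard k \<tau> y)) \<partial>lborel)"
    by (intro nn_integral_monotone_convergence_SUP incseq_SucI le_funI ennreal_leI mult_left_mono
        f_ext_mono picard_le_Suc kernel_nonneg) measurable
  finally show ?thesis .
qed

lemma SUP_picard_Suc: "(SUP k. ennreal (picard (Suc k) t x)) = (SUP k. ennreal (picard k t x))"
proof (rule antisym)
  show "(SUP k. ennreal (picard (Suc k) t x)) \<le> (SUP k. ennreal (picard k t x))"
    by (rule SUP_mono) blast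
  show "(SUP k. ennreal (picard k t x)) \<le> (SUP k. ennreal (picard (Suc k) t x))"
    by (rule SUP_mono) (blast intro: ennreal_leI picard_le_Suc)
qed

lemma duhamel_picard_lim: "duhamel picard_lim t x = ennreal (picard_lim t x)"
proof -
  let ?I = "\<lambda>k \<tau>. (\<integral>\<^sup>+ y. ennreal (\<Gamma> 0 y (t - \<tau>) x * f_ext (picard k \<tau> y)) \<partial>lborel) * indicator {0..t} \<tau>"
  have "(\<integral>\<^sup>+ \<tau>. (SUP k. ?I k \<tau>) \<partial>lborel) = (SUP k. \<integral>\<^sup>+ \<tau>. ?I k \<tau> \<partial>lborel)"
    by (intro nn_integral_monotone_convergence_SUP incseq_SucI le_funI mult_right_mono nn_integral_mono
        ennreal_leI mult_left_mono f_ext_mono picard_le_Suc kernel_nonneg) auto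
  then have "duhamel picard_lim t x = (SUP k. heat_u0 t x + (\<integral>\<^sup>+ \<tau>. ?I k \<tau> \<partial>lborel))"
    unfolding duhamel_def nn_integral_f_ext_picard_lim
    by (simp add: SUP_mult_right_ennreal ennreal_SUP_add_right)
  also have "\<dots> = (SUP k. ennreal (picard (Suc k) t x))"
    by (simp only: duhamel_def[symmetric] duhamel_picard)
  finally show ?thesis by (simp only: SUP_picard_Suc ennreal_picard_lim)
qed

text \<open>The kernel vanishes at time \<open>0\<close>, so \<open>picard_lim 0 = 0\<close>: the initial datum is attached by hand.\<close>

definition mild_sol :: "real \<Rightarrow> real^'n \<Rightarrow> real" where
  "mild_sol t x = (if t = 0 then max (u0 x) 0 else picard_lim t x)"

lemma mild_sol_measurable: "(\<lambda>p. mild_sol (fst p) (snd p)) \<in> borel_measurable borel"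
proof -
  have "(\<lambda>p. mild_sol (fst p) (snd p)) \<in> borel_measurable (lborel \<Otimes>\<^sub>M lborel)"
    unfolding mild_sol_def by measurable
  then show ?thesis by (simp add: lborel_prod)
qed

lemma mild_sol_nonneg: "0 \<le> mild_sol t x"
  unfolding mild_sol_def by (simp add: picard_lim_nonneg)

lemma mild_sol_integrable:
  assumes "t \<ge> 0"
  shows "integrable lborel (mild_sol t)"
proof -
  have "(\<lambda>(t, x). mild_sol t x) \<in> borel_measurable (lborel \<Otimes>\<^sub>M lborel)"
    unfolding mild_sol_def by measurable
  from measurable_Pair2[OF this, of t] have "mild_sol t \<in> borel_measurable lborel" by simp
  moreover have "(\<integral>\<^sup>+ x. ennreal (mild_sol t x) \<partial>lborel) \<le> 2 * ennreal \<epsilon>"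
  proof (cases "t = 0")
    case True
    have "(\<integral>\<^sup>+ x. ennreal (mild_sol t x) \<partial>lborel) = (\<integral>\<^sup>+ x. ennreal (u0 x) \<partial>lborel)"
      using True by (intro nn_integral_cong) (simp add: mild_sol_def max_def ennreal_neg)
    also have "\<dots> \<le> 2 * ennreal \<epsilon>"
      using nn_integral_u0_le by (rule order_trans) (simp add: mult_2)
    finally show ?thesis .
  next
    case False
    with assms have "t > 0" by simp
    have "(\<integral>\<^sup>+ x. ennreal (mild_sol t x) \<partial>lborel) \<le> (\<integral>\<^sup>+ x. 2 * heat_u0 t x \<partial>lborel)"
      using False
      by (intro nn_integral_mono) (simp add: mild_sol_def ennreal_double_heat_u0_real[symmetric] ennreal_leI picard_lim_le)
    also have "\<dots> = 2 * (\<integral>\<^sup>+ y. ennreal (u0 y) \<partial>lborel)"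
      by (simp add: nn_integral_cmult nn_integral_heat_u0[OF \<open>t > 0\<close>])
    also have "\<dots> \<le> 2 * ennreal \<epsilon>"
      using nn_integral_u0_le by (rule mult_left_mono) simp
    finally show ?thesis .
  qed
  ultimately show ?thesis
    using mild_sol_nonneg by (intro integrableI_nonneg) (auto simp: ennreal_mult_less_top le_less_trans)
qed

lemma mild_sol_initial: "AE x in lborel. mild_sol 0 x = u0 x"
  using u0_nonneg by eventually_elim (simp add: mild_sol_def)

lemma mild_sol_duhamel:
  assumes "t > 0"
  shows "ennreal (mild_sol t x) = (\<integral>\<^sup>+ y. ennreal (\<Gamma> 0 y t x * u0 y) \<partial>lborel) +
     (\<integral>\<^sup>+ \<tau>\<in>{0..t}. (\<integral>\<^sup>+ y. ennreal (\<Gamma> 0 y (t - \<tau>) x * f (mild_sol \<tau> y)) \<partial>lborel) \<partial>lborel)"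
proof -
  have "ennreal (mild_sol t x) = duhamel picard_lim t x"
    using assms by (simp add: mild_sol_def duhamel_picard_lim)
  also have "\<dots> = heat_u0 t x +
      (\<integral>\<^sup>+ \<tau>\<in>{0..t}. (\<integral>\<^sup>+ y. ennreal (\<Gamma> 0 y (t - \<tau>) x * f (mild_sol \<tau> y)) \<partial>lborel) \<partial>lborel)"
    unfolding duhamel_def
    \<comment> \<open>\<open>mild_sol\<close> and \<open>picard_lim\<close> differ only at the null time \<open>\<tau> = 0\<close>\<close>
    using AE_lborel_singleton[of 0]
    by (intro arg_cong2[where f="(+)"] refl nn_integral_cong_AE, eventually_elim)
      (simp add: mild_sol_def f_ext_def max_absorb1 picard_lim_nonneg)
  finally show ?thesis unfolding heat_u0_def .
qed

lemma mild_solution_exists: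
  "\<exists>u :: real \<Rightarrow> real^'n \<Rightarrow> real.
      (\<lambda>p. u (fst p) (snd p)) \<in> borel_measurable borel \<and>
      (\<forall>t\<ge>0. \<forall>x. u t x \<ge> 0) \<and>
      (\<forall>t\<ge>0. integrable lborel (u t)) \<and>
      (AE x in lborel. u 0 x = u0 x) \<and>
      (\<forall>t>0. AE x in lborel.
         ennreal (u t x) =
           (\<integral>\<^sup>+ y. ennreal (\<Gamma> 0 y t x * u0 y) \<partial>lborel) +
           (\<integral>\<^sup>+ \<tau>\<in>{0..t}. (\<integral>\<^sup>+ y. ennreal (\<Gamma> 0 y (t - \<tau>) x * f (u \<tau> y)) \<partial>lborel) \<partial>lborel))"
  using mild_sol_measurable mild_sol_nonneg mild_sol_integrable mild_sol_initial mild_sol_duhamel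
  by (intro exI[of _ mild_sol]) auto

end

theorem mainTheorem3:
  fixes X :: "nat \<Rightarrow> real^'n \<Rightarrow> real^'n" and m :: nat and \<sigma> :: "'n \<Rightarrow> nat"
    and \<Gamma> :: "real \<Rightarrow> real^'n \<Rightarrow> real \<Rightarrow> real^'n \<Rightarrow> real"
    and f :: "real \<Rightarrow> real" and A \<alpha> :: real
  assumes hX: "hom_hoermander X m \<sigma>"
    and hG: "heat_kernel_props X m \<Gamma>"
    and hB: "ball_volume_bound X m (\<Sum>i\<in>UNIV. \<sigma> i)"
    and f_cont: "continuous_on {0..} f"
    and f_mono: "mono_on {0..} f"
    and f_nonneg: "\<forall>u\<ge>0. f u \<ge> 0"
    and f_bound: "\<forall>u\<ge>0. f u \<le> A * u powr \<alpha>"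
    and A_pos: "A > 0"
    and \<alpha>_gt: "\<alpha> > 1 + 2 / real (\<Sum>i\<in>UNIV. \<sigma> i)"
  shows "\<exists>\<epsilon>>0. \<forall>u0 :: real^'n \<Rightarrow> real.
      (AE x in lborel. u0 x \<ge> 0) \<and> integrable lborel u0 \<and>
      esssup lborel (\<lambda>x. ereal \<bar>u0 x\<bar>) < \<infinity> \<and>
      (\<integral>x. \<bar>u0 x\<bar> \<partial>lborel) < \<epsilon> \<and> esssup lborel (\<lambda>x. ereal \<bar>u0 x\<bar>) < ereal \<epsilon>
      \<longrightarrow>
      ((\<forall>t>0. esssup lborel (\<lambda>x. ereal \<bar>\<integral>y. \<Gamma> 0 y t x * u0 y \<partial>lborel\<bar>) < \<infinity>) \<and>
       (\<integral>\<^sup>+ t\<in>{0<..}.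
          ennreal (real_of_ereal (esssup lborel (\<lambda>x. ereal \<bar>\<integral>y. \<Gamma> 0 y t x * u0 y \<partial>lborel\<bar>))
                   powr (\<alpha> - 1)) \<partial>lborel)
         < ennreal (1 / (A * (\<alpha> - 1))))
      \<and>
      (\<exists>u :: real \<Rightarrow> real^'n \<Rightarrow> real.
          (\<lambda>p. u (fst p) (snd p)) \<in> borel_measurable borel \<and>
          (\<forall>t\<ge>0. \<forall>x. u t x \<ge> 0) \<and>
          (\<forall>t\<ge>0. integrable lborel (u t)) \<and>
          (AE x in lborel. u 0 x = u0 x) \<and>
          (\<forall>t>0. AE x in lborel.
             ennreal (u t x) =
               (\<integral>\<^sup>+ y. ennreal (\<Gamma> 0 y t x * u0 y) \<partial>lborel) +
               (\<integral>\<^sup>+ \<tau>\<in>{0..t}. (\<integral>\<^sup>+ y. ennreal (\<Gamma> 0 y (t - \<tau>) x * f (u \<tau> y)) \<partial>lborel) \<partial>lborel)))"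
proof -
  let ?q = "real (\<Sum>i\<in>UNIV. \<sigma> i)"
  obtain M where "heat_kernel \<Gamma> M ?q"
    using heat_kernel_if_props[OF hG hB hom_hoermander_homogeneous_dim_pos[OF hX]] by blast
  then interpret heat_kernel \<Gamma> M ?q .
  have "\<alpha> - 1 > 0"
    using \<alpha>_gt q_pos by (smt (verit) divide_pos_pos)
  obtain \<epsilon> where "\<epsilon> > 0"
    and small: "ennreal (A * 2 powr \<alpha> * \<epsilon> powr (\<alpha> - 1)) * decay_integral (\<alpha> - 1) \<le> 1"
    and decay: "ennreal (\<epsilon> powr (\<alpha> - 1)) * decay_integral (\<alpha> - 1) < ennreal (1 / (A * (\<alpha> - 1)))"
    using ex_small_data_threshold[OF A_pos \<alpha>_gt] by blast
  show ?thesis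
    apply (intro exI[of _ \<epsilon>] conjI[OF \<open>\<epsilon> > 0\<close>] allI impI)
    subgoal premises u0 for u0
    proof -
      interpret mild_problem \<Gamma> M ?q u0 \<epsilon> f A \<alpha>
        using u0 f_cont f_mono f_nonneg f_bound A_pos \<open>\<alpha> - 1 > 0\<close> small
        by (intro mild_problem.intro heat_flow.intro heat_kernel_axioms heat_flow_axioms.intro
            mild_problem_axioms.intro) auto
      from order.strict_trans1[OF nn_integral_esssup_heat_u0_powr_le[OF \<open>\<alpha> - 1 > 0\<close>] decay]
      show ?thesis using esssup_heat_u0_finite mild_solution_exists by blast
    qed
    done
qed

end
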